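(* Let $f$, $M$, $l_f$, $L_M$ satisfy A1) and A2), let $x_0\in\mathbb{R}^d$, and let $0=t_0<t_1<\dots<t_N=T$ be a grid with step-sizes $h_n=t_{n+1}-t_n$ satisfying A3). Let $C$, $P$, $\Gamma$ be as in the context. Then for every solution $x(\cdot)$ of the differential inclusion $\dot x(t)\in f(t,x(t))+M(t,x(t))$, $t\in[0,T]$, $x(0)=x_0$, there exists a sequence $\{y_n\}_{n=0}^N$ with $y_0=x_0$ and $y_{n+1}\in\Phi(t_n,y_n;h_n)$ for $n=0,\dots,N-1$ such that $$|x(t_n)-y_n|\le\sum_{k=0}^{n-1}e^{\sum_{j=k}^{n-1}\frac{l_f(t_{j+1})h_j}{1-l_f(t_{j+1})h_j}+\sum_{j=k+1}^{n-1}L_M(t_j)h_j}\,h_k\,\Gamma(h_k,t_k)$$ for $n=0,\dots,N$.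
   Context: $|\cdot|$ is the Euclidean norm on $\mathbb{R}^d$, $\|A\|=\sup_{a\in A}|a|$, $B_C(0)$ is the closed ball of radius $C$. For nonempty compact $A,B\subset\mathbb{R}^d$, $\operatorname{dist}(A,B)=\sup_{a\in A}\inf_{b\in B}|a-b|$ and $\operatorname{dist}_H(A,B)=\max\{\operatorname{dist}(A,B),\operatorname{dist}(B,A)\}$. Let $T>0$. A1) $f:[0,T]\times\mathbb{R}^d\to\mathbb{R}^d$ is continuous and there is a continuous function $l_f:[0,T]\to\mathbb{R}$ such that $\langle f(t,x)-f(t,x'),x-x'\rangle\le l_f(t)|x-x'|^2$ for all $t\in[0,T]$, $x,x'\in\mathbb{R}^d$. A2) $M:[0,T]\times\mathbb{R}^d\to\{\text{nonempty convex compact subsets of }\mathbb{R}^d\}$ is continuous with respect to the Hausdorff metric and there is a continuous function $L_M:[0,T]\to[0,\infty)$ such that $\operatorname{dist}_H(M(t,x),M(t,x'))\le L_M(t)|x-x'|$ for all $t\in[0,T]$, $x,x'\in\mathbb{R}^d$. A3) $l_f(t_{n+1})h_n<1$ for all $n\in\{0,\dots,N-1\}$. A solution of the differential inclusion is an absolutely continuous function $x:[0,T]\to\mathbb{R}^d$ satisfying the inclusion almost everywhere and the initial condition. The parameterized semi-implicit Euler scheme is $\Phi(t,x;h)=\{z\in\mathbb{R}^d: z\in x+hf(t+h,z)+hM(t,x)\}$; its trajectories are the sequences with $y_0=x_0$, $y_{n+1}\in\Phi(t_n,y_n;h_n)$. $C>0$ is a constant such that all solutions of the differential inclusion and all trajectories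 of $\Phi$ (with initial value $x_0$) are contained in $B_C(0)$ (such a $C$ exists). Set, for $\delta\ge0$, $\tau_f(\delta)=\sup\{|f(t,x)-f(t',x)|:t,t'\in[0,T],|t-t'|\le\delta,x\in B_C(0)\}$, $\chi_f(\delta)=\sup\{|f(t,x)-f(t,x')|:t\in[0,T],x,x'\in B_C(0),|x-x'|\le\delta\}$, $\tau_M(\delta)=\sup\{\operatorname{dist}(M(t,x),M(t',x)):t,t'\in[0,T],|t-t'|\le\delta,x\in B_C(0)\}$, $P=\max_{[0,T]\times B_C(0)}|f|+\max_{[0,T]\times B_C(0)}\|M\|$, and $\Gamma(h,t)=\tau_f(h)+\chi_f(Ph)+\tau_M(h)+L_M(t)Ph$. *)

theory Defs
  imports "HOL-Analysis.Analysis"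
begin

section \<open>Set distances\<close>

text \<open>
  The real-valued suprema in this theory are meaningful because they are only taken over
  nonempty sets that are bounded above: the set-valued map has nonempty compact values, and
  everything depends continuously on its arguments in a compact set. On such sets
  \<^term>\<open>infdist a B\<close> is the infimum of \<^term>\<open>dist a b\<close> over \<^term>\<open>b \<in> B\<close>.
\<close>

definition excess :: "'a::metric_space set \<Rightarrow> 'a set \<Rightarrow> real" where
  "excess A B = (SUP a\<in>A. infdist a B)"

definition hausdorff_dist :: "'a::metric_space set \<Rightarrow> 'a set \<Rightarrow> real" where
  "hausdorff_dist A B = max (excess A B) (excess B A)"

definition hausdorff_continuous_on ::
    "'b::topological_space set \<Rightarrow> ('b \<Rightarrow> 'a::metric_space set) \<Rightarrow> bool" where
  "hausdorff_continuous_on S F \<longleftrightarrow>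
     (\<forall>p\<in>S. ((\<lambda>q. hausdorff_dist (F q) (F p)) \<longlongrightarrow> 0) (at p within S))"

definition set_norm :: "'a::real_normed_vector set \<Rightarrow> real" where
  "set_norm A = (SUP a\<in>A. norm a)"


section \<open>Solutions of differential inclusions\<close>

text \<open>A pair \<^term>\<open>(u, v)\<close> encodes the open interval between \<^term>\<open>u\<close> and \<^term>\<open>v\<close>.\<close>

definition absolutely_continuous_fun_on ::
    "real \<Rightarrow> real \<Rightarrow> (real \<Rightarrow> 'a::real_normed_vector) \<Rightarrow> bool" where
  "absolutely_continuous_fun_on a b x \<longleftrightarrow>
     (\<forall>\<epsilon>>0. \<exists>\<delta>>0. \<forall>D :: (real \<times> real) set.
        finite D \<longrightarrow>
        (\<forall>(u, v)\<in>D. a \<le> u \<and> u < v \<and> v \<le> b) \<longrightarrow>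
        disjoint_family_on (\<lambda>(u, v). {u<..<v}) D \<longrightarrow>
        (\<Sum>(u, v)\<in>D. v - u) < \<delta> \<longrightarrow>
        (\<Sum>(u, v)\<in>D. norm (x v - x u)) < \<epsilon>)"

definition di_solution ::
    "real \<Rightarrow> (real \<Rightarrow> 'a::real_normed_vector \<Rightarrow> 'a set) \<Rightarrow> 'a \<Rightarrow> (real \<Rightarrow> 'a) \<Rightarrow> bool" where
  "di_solution T F x0 x \<longleftrightarrow>
     absolutely_continuous_fun_on 0 T x \<and>
     (AE t in lebesgue_on {0..T}.
        \<exists>v. (x has_vector_derivative v) (at t within {0..T}) \<and> v \<in> F t (x t)) \<and>
     x 0 = x0"

definition perturbed_rhs ::
    "(real \<Rightarrow> 'a \<Rightarrow> 'a) \<Rightarrow> (real \<Rightarrow> 'a \<Rightarrow> 'a set) \<Rightarrow> real \<Rightarrow> 'a \<Rightarrow> 'a::real_normed_vector set" where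
  "perturbed_rhs f M t x = {f t x + m | m. m \<in> M t x}"


section \<open>The semi-implicit Euler scheme\<close>

definition step_size :: "(nat \<Rightarrow> real) \<Rightarrow> nat \<Rightarrow> real" where
  "step_size t n = t (Suc n) - t n"

definition semi_implicit_euler ::
    "(real \<Rightarrow> 'a \<Rightarrow> 'a) \<Rightarrow> (real \<Rightarrow> 'a \<Rightarrow> 'a set) \<Rightarrow> real \<Rightarrow> 'a \<Rightarrow> real \<Rightarrow> 'a::real_normed_vector set" where
  "semi_implicit_euler f M t x h =
     {z. \<exists>m\<in>M t x. z = x + h *\<^sub>R f (t + h) z + h *\<^sub>R m}"

text \<open>Only the values \<^term>\<open>y n\<close> with \<^term>\<open>n \<le> N\<close> matter.\<close>

definition euler_trajectory ::
    "(real \<Rightarrow> 'a \<Rightarrow> 'a) \<Rightarrow> (real \<Rightarrow> 'a \<Rightarrow> 'a set) \<Rightarrow> nat \<Rightarrow> (nat \<Rightarrow> real) \<Rightarrow> 'a \<Rightarrow>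
     (nat \<Rightarrow> 'a::real_normed_vector) \<Rightarrow> bool" where
  "euler_trajectory f M N t x0 y \<longleftrightarrow>
     y 0 = x0 \<and> (\<forall>n<N. y (Suc n) \<in> semi_implicit_euler f M (t n) (y n) (step_size t n))"


section \<open>Moduli of continuity and the local error\<close>

definition tau_f ::
    "real \<Rightarrow> real \<Rightarrow> (real \<Rightarrow> 'a \<Rightarrow> 'a::real_normed_vector) \<Rightarrow> real \<Rightarrow> real" where
  "tau_f T C f \<delta> = Sup {norm (f t x - f t' x) | t t' x.
     t \<in> {0..T} \<and> t' \<in> {0..T} \<and> \<bar>t - t'\<bar> \<le> \<delta> \<and> x \<in> cball 0 C}"

definition chi_f ::
    "real \<Rightarrow> real \<Rightarrow> (real \<Rightarrow> 'a \<Rightarrow> 'a::real_normed_vector) \<Rightarrow> real \<Rightarrow> real" where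
  "chi_f T C f \<delta> = Sup {norm (f t x - f t x') | t x x'.
     t \<in> {0..T} \<and> x \<in> cball 0 C \<and> x' \<in> cball 0 C \<and> norm (x - x') \<le> \<delta>}"

definition tau_M ::
    "real \<Rightarrow> real \<Rightarrow> (real \<Rightarrow> 'a \<Rightarrow> 'a::real_normed_vector set) \<Rightarrow> real \<Rightarrow> real" where
  "tau_M T C M \<delta> = Sup {excess (M t x) (M t' x) | t t' x.
     t \<in> {0..T} \<and> t' \<in> {0..T} \<and> \<bar>t - t'\<bar> \<le> \<delta> \<and> x \<in> cball 0 C}"

text \<open>The suprema below are attained, so they are the maxima of the two functions.\<close>

definition bound_P ::
    "real \<Rightarrow> real \<Rightarrow> (real \<Rightarrow> 'a \<Rightarrow> 'a) \<Rightarrow> (real \<Rightarrow> 'a \<Rightarrow> 'a::real_normed_vector set) \<Rightarrow> real" where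
  "bound_P T C f M =
     (SUP (t, x)\<in>{0..T} \<times> cball 0 C. norm (f t x)) +
     (SUP (t, x)\<in>{0..T} \<times> cball 0 C. set_norm (M t x))"

definition local_error ::
    "real \<Rightarrow> real \<Rightarrow> (real \<Rightarrow> 'a \<Rightarrow> 'a) \<Rightarrow> (real \<Rightarrow> 'a \<Rightarrow> 'a::real_normed_vector set) \<Rightarrow>
     (real \<Rightarrow> real) \<Rightarrow> real \<Rightarrow> real \<Rightarrow> real" where
  "local_error T C f M L_M h t =
     tau_f T C f h + chi_f T C f (bound_P T C f M * h) + tau_M T C M h
     + L_M t * bound_P T C f M * h"

end

theory Submission
  imports Defs
begin

text \<open>
  On a step from \<open>a\<close> to \<open>b = a + h\<close> the derivative of the solution lies, for almost every time, in a
  neighbourhood of the convex set \<open>f(b, x(b)) + M(a, y)\<close> whose radius is controlled by the moduli of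
  continuity and by \<open>|x(a) - y|\<close>. A mean value theorem for absolutely continuous functions puts the
  difference quotient into that neighbourhood. Hence \<open>x(b) = x(a) + h f(b, x(b)) + h m + h e\<close> with
  \<open>m \<in> M(a, y)\<close> and a small \<open>e\<close>. The Euler iterate is the solution of \<open>z = y + h f(b, z) + h m\<close> with
  the same \<open>m\<close>, and the one-sided Lipschitz condition amplifies the difference of the two equations
  by at most \<open>1 / (1 - l h) = 1 + l h / (1 - l h)\<close>.
\<close>

section \<open>A mean value theorem for absolutely continuous functions\<close>

text \<open>Turns an almost-everywhere statement into an explicit null set, the form in which the
  gauge argument takes its exceptional points.\<close>

lemma AE_lebesgue_on_negligible:
  assumes "AE s in lebesgue_on S. P s" "S \<in> sets lebesgue"
  obtains E where "negligible E" "\<And>s. s \<in> S \<Longrightarrow> s \<notin> E \<Longrightarrow> P s"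
proof -
  have "AE s in lebesgue. s \<in> S \<longrightarrow> P s"
    using assms by (simp add: AE_restrict_space_iff)
  then obtain E where E: "negligible E" "{s. \<not> (s \<in> S \<longrightarrow> P s)} \<subseteq> E"
    unfolding eventually_ae_filter_negligible by (elim exE conjE)
  show ?thesis by (rule that[OF E(1)]) (use E(2) in auto)
qed

lemma absolutely_continuous_fun_onE:
  assumes "absolutely_continuous_fun_on a b x" "\<epsilon> > 0"
  obtains \<delta> where "\<delta> > 0" "\<And>D. \<lbrakk>finite D; \<forall>(u, v)\<in>D. a \<le> u \<and> u < v \<and> v \<le> b;
      disjoint_family_on (\<lambda>(u, v). {u<..<v}) D; (\<Sum>(u, v)\<in>D. v - u) < \<delta>\<rbrakk>
        \<Longrightarrow> (\<Sum>(u, v)\<in>D. norm (x v - x u)) < \<epsilon>"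
  using assms(1)[unfolded absolutely_continuous_fun_on_def, rule_format, OF assms(2)]
  by (elim exE conjE) (rule that, assumption, simp)

text \<open>The errors allowed at \<open>u\<close> and at \<open>v\<close> are at most
  \<open>\<epsilon> * (s - u)\<close> and \<open>\<epsilon> * (v - s)\<close>; since
  \<open>s\<close> lies between the two points, they add up to
  \<open>\<epsilon> * (v - u)\<close>.\<close>

lemma real_derivative_straddle:
  fixes g :: "real \<Rightarrow> real"
  assumes "(g has_vector_derivative d) (at s within S)" "\<epsilon> > 0"
  obtains r where "r > 0"
    "\<And>u v. u \<in> S \<Longrightarrow> v \<in> S \<Longrightarrow> u \<le> s \<Longrightarrow> s \<le> v \<Longrightarrow> \<bar>u - s\<bar> < r \<Longrightarrow> \<bar>v - s\<bar> < r
       \<Longrightarrow> g v - g u \<le> (d + \<epsilon>) * (v - u)"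
proof -
  have "(g has_derivative (\<lambda>h. h * d)) (at s within S)"
    using assms(1) by (simp add: has_vector_derivative_def)
  then obtain r where r: "r > 0" and
    est: "\<And>w. w \<in> S \<Longrightarrow> \<bar>w - s\<bar> < r \<Longrightarrow> \<bar>g w - g s - (w - s) * d\<bar> \<le> \<epsilon> * \<bar>w - s\<bar>"
    using assms(2) unfolding has_derivative_within_alt by (auto simp: real_norm_def)
  show ?thesis
  proof (rule that[OF r])
    fix u v assume uv: "u \<in> S" "v \<in> S" "u \<le> s" "s \<le> v" "\<bar>u - s\<bar> < r" "\<bar>v - s\<bar> < r"
    have "g v - g s - (v - s) * d \<le> \<epsilon> * (v - s)" "- (g u - g s - (u - s) * d) \<le> \<epsilon> * (s - u)"
      using est[of u] est[of v] uv by auto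
    then show "g v - g u \<le> (d + \<epsilon>) * (v - u)"
      by (simp add: algebra_simps)
  qed
qed

section \<open>Open covers of null sets and tagged divisions of an interval\<close>

lemma negligible_open_cover:
  fixes E :: "'a::euclidean_space set"
  assumes E: "negligible E" and "e > 0"
  obtains U where "open U" "E \<subseteq> U" "U \<in> lmeasurable" "measure lebesgue U < e"
proof -
  obtain U where U: "open U" "E \<subseteq> U" "(U - E) \<in> lmeasurable" "emeasure lebesgue (U - E) < ennreal e"
    using sets_lebesgue_outer_open[OF negligible_imp_sets[OF E] \<open>e > 0\<close>] .
  have "U = (U - E) \<union> E" using U by auto
  then have lm: "U \<in> lmeasurable"
    using fmeasurable.Un[OF U(3) negligible_imp_measurable[OF E]] by simp
  have "measure lebesgue U = measure lebesgue (U - E)"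
    using measure_Diff_null_set[of U lebesgue E] E lm by (simp add: negligible_iff_null_sets)
  also have "\<dots> < e"
    using U(3,4) by (simp add: emeasure_eq_measure2 ennreal_less_iff)
  finally show ?thesis using that U(1,2) lm by blast
qed

lemma tagged_partial_division_real_interval:
  fixes K :: "real set"
  assumes "p tagged_partial_division_of {a..b}" "(s, K) \<in> p"
  shows "K = {Inf K..Sup K}" "a \<le> Inf K" "Inf K \<le> s" "s \<le> Sup K" "Sup K \<le> b"
    "interior K = {Inf K<..<Sup K}"
proof -
  obtain u v where K: "K = {u..v}" "s \<in> K" "K \<subseteq> {a..b}"
    using tagged_partial_division_ofD(2-4)[OF assms] by auto
  then have uv: "u \<le> v" "Inf K = u" "Sup K = v" by auto
  show "K = {Inf K..Sup K}" "a \<le> Inf K" "Inf K \<le> s" "s \<le> Sup K" "Sup K \<le> b"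
    using K uv by auto
  show "interior K = {Inf K<..<Sup K}"
    unfolding uv unfolding K by (rule interior_atLeastAtMost_real)
qed

lemma absolutely_continuous_tagged_partial_division:
  fixes x :: "real \<Rightarrow> 'a::real_normed_vector"
  assumes ac: "absolutely_continuous_fun_on a b x" and "\<epsilon> > 0"
  obtains \<delta> where "\<delta> > 0" "\<And>q. \<lbrakk>q tagged_partial_division_of {a..b}; \<forall>(s, K)\<in>q. Inf K < Sup K;
      (\<Sum>(s, K)\<in>q. Sup K - Inf K) < \<delta>\<rbrakk> \<Longrightarrow> (\<Sum>(s, K)\<in>q. norm (x (Sup K) - x (Inf K))) < \<epsilon>"
proof -
  obtain \<delta> where \<delta>: "\<delta> > 0" and small: "\<And>D. \<lbrakk>finite D; \<forall>(u, v)\<in>D. a \<le> u \<and> u < v \<and> v \<le> b;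
      disjoint_family_on (\<lambda>(u, v). {u<..<v}) D; (\<Sum>(u, v)\<in>D. v - u) < \<delta>\<rbrakk>
      \<Longrightarrow> (\<Sum>(u, v)\<in>D. norm (x v - x u)) < \<epsilon>"
    by (rule absolutely_continuous_fun_onE[OF ac \<open>\<epsilon> > 0\<close>]) (rule that)
  show ?thesis
  proof (rule that[OF \<delta>])
    fix q :: "(real \<times> real set) set"
    assume q: "q tagged_partial_division_of {a..b}" and nondeg: "\<forall>(s, K)\<in>q. Inf K < Sup K"
      and len: "(\<Sum>(s, K)\<in>q. Sup K - Inf K) < \<delta>"
    have fin: "finite q" using q by (rule tagged_partial_division_ofD)
    define e where "e = (\<lambda>(s::real, K). (Inf K, Sup K) :: real \<times> real)"
    note K = tagged_partial_division_real_interval[OF q]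
    have disj: "{Inf K<..<Sup K} \<inter> {Inf K'<..<Sup K'} = {}"
      if "(s, K) \<in> q" "(s', K') \<in> q" "(s, K) \<noteq> (s', K')" for s K s' K'
      using tagged_partial_division_ofD(5)[OF q that] K(6)[OF that(1)] K(6)[OF that(2)] by simp
    \<comment> \<open>Forgetting the tags must not merge members: two distinct ones with the same
      endpoints would share a nonempty open interval.\<close>
    have inj: "inj_on e q"
    proof (rule inj_onI, clarify)
      fix s K s' K' assume *: "(s, K) \<in> q" "(s', K') \<in> q" "e (s, K) = e (s', K')"
      then have "Inf K = Inf K'" "Sup K = Sup K'" "Inf K < Sup K" using nondeg by (auto simp: e_def)
      then show "s = s' \<and> K = K'" using disj[OF *(1,2)] by (cases "(s, K) = (s', K')") auto
    qed
    have sum_e: "(\<Sum>(u, v)\<in>e ` q. F u v) = (\<Sum>(s, K)\<in>q. F (Inf K) (Sup K))"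
      for F :: "real \<Rightarrow> real \<Rightarrow> real"
      unfolding sum.reindex[OF inj] by (simp add: e_def case_prod_unfold)
    have "(\<Sum>(u, v)\<in>e ` q. norm (x v - x u)) < \<epsilon>"
    proof (rule small)
      show "finite (e ` q)" using fin by simp
      show "\<forall>(u, v)\<in>e ` q. a \<le> u \<and> u < v \<and> v \<le> b" using K nondeg by (auto simp: e_def)
      show "disjoint_family_on (\<lambda>(u, v). {u<..<v}) (e ` q)"
        unfolding disjoint_family_on_def
      proof (intro ballI impI)
        fix i j assume "i \<in> e ` q" "j \<in> e ` q" "i \<noteq> j"
        then obtain s K s' K' where *: "(s, K) \<in> q" "(s', K') \<in> q" "(s, K) \<noteq> (s', K')"
          "i = (Inf K, Sup K)" "j = (Inf K', Sup K')" by (auto simp: e_def)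
        show "(case i of (u, v) \<Rightarrow> {u<..<v}) \<inter> (case j of (u, v) \<Rightarrow> {u<..<v}) = {}"
          using disj[OF *(1-3)] by (simp add: *(4,5))
      qed
      show "(\<Sum>(u, v)\<in>e ` q. v - u) < \<delta>"
        unfolding sum_e by (rule len)
    qed
    then show "(\<Sum>(s, K)\<in>q. norm (x (Sup K) - x (Inf K))) < \<epsilon>"
      unfolding sum_e .
  qed
qed

text \<open>The interiors are pairwise disjoint subsets of \<open>U\<close>, and each has the length
  of its interval as measure. Interiors are used because neighbouring intervals may share
  endpoints.\<close>

lemma tagged_partial_division_length_le:
  fixes q :: "(real \<times> real set) set"
  assumes q: "q tagged_partial_division_of {a..b}" and U: "U \<in> lmeasurable"
    and sub: "\<And>s K. (s, K) \<in> q \<Longrightarrow> K \<subseteq> U"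
  shows "(\<Sum>(s, K)\<in>q. Sup K - Inf K) \<le> measure lebesgue U"
proof -
  note K = tagged_partial_division_real_interval[OF q]
  have fin: "finite q" using q by (rule tagged_partial_division_ofD)
  have lm: "interior (snd i) \<in> lmeasurable" if "i \<in> q" for i
    using K(6)[of "fst i" "snd i"] that by simp
  have "(\<Sum>(s, K)\<in>q. Sup K - Inf K) = (\<Sum>i\<in>q. measure lebesgue (interior (snd i)))"
  proof (intro sum.cong refl)
    fix i assume i: "i \<in> q"
    then have "Inf (snd i) \<le> Sup (snd i)" using K(3,4)[of "fst i" "snd i"] by simp
    then show "(case i of (s, K) \<Rightarrow> Sup K - Inf K) = measure lebesgue (interior (snd i))"
      using K(6)[of "fst i" "snd i"] i by (simp add: case_prod_unfold)
  qed
  also have "\<dots> = measure lebesgue (\<Union>i\<in>q. interior (snd i))"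
  proof (rule measure_UNION'[symmetric, OF fin lm])
    show "pairwise (\<lambda>i j. disjnt (interior (snd i)) (interior (snd j))) q"
    proof (rule pairwiseI)
      fix i j assume "i \<in> q" "j \<in> q" "i \<noteq> j"
      then show "disjnt (interior (snd i)) (interior (snd j))"
        using tagged_partial_division_ofD(5)[OF q, of "fst i" "snd i" "fst j" "snd j"]
        by (simp add: disjnt_def)
    qed
  qed
  also have "\<dots> \<le> measure lebesgue U"
  proof (rule measure_mono_fmeasurable[OF _ _ U])
    show "(\<Union>i\<in>q. interior (snd i)) \<subseteq> U"
    proof (rule UN_least)
      fix i assume "i \<in> q"
      then show "interior (snd i) \<subseteq> U"
        using sub[of "fst i" "snd i"] order_trans[OF interior_subset] by simp
    qed
    show "(\<Union>i\<in>q. interior (snd i)) \<in> sets lebesgue"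
      using fin lm by (intro sets.finite_UN) auto
  qed
  finally show ?thesis .
qed

text \<open>A gauge argument: at a tag outside the exceptional null set the interval is controlled by the
  derivative; the intervals tagged in the null set lie in an open set of small measure, so absolute
  continuity controls the sum of their increments.\<close>

lemma absolutely_continuous_increment_le:
  fixes g :: "real \<Rightarrow> real"
  assumes ac: "absolutely_continuous_fun_on a b g" and "a \<le> b" and E: "negligible E"
    and der: "\<And>s. s \<in> {a..b} \<Longrightarrow> s \<notin> E \<Longrightarrow>
       \<exists>d. (g has_vector_derivative d) (at s within {a..b}) \<and> d \<le> \<beta>"
  shows "g b - g a \<le> \<beta> * (b - a)"
proof -
  \<comment> \<open>The slack has three sources: the straddle estimate raises the slope by
    \<open>\<epsilon>\<close>, the increments over intervals tagged in \<open>E\<close> sum to less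
    than \<open>\<epsilon>\<close>, and the linear part on those intervals costs at most
    \<open>\<bar>\<beta>\<bar> + \<epsilon>\<close> times their total length, which is below
    \<open>\<epsilon>\<close>.\<close>
  have approx: "g b - g a \<le> (\<beta> + \<epsilon>) * (b - a) + \<epsilon> + (\<bar>\<beta>\<bar> + \<epsilon>) * \<epsilon>" if "\<epsilon> > 0" for \<epsilon>
  proof -
    obtain \<delta> where \<delta>: "\<delta> > 0" and small: "\<And>q. \<lbrakk>q tagged_partial_division_of {a..b};
        \<forall>(s, K)\<in>q. Inf K < Sup K; (\<Sum>(s, K)\<in>q. Sup K - Inf K) < \<delta>\<rbrakk>
        \<Longrightarrow> (\<Sum>(s, K)\<in>q. norm (g (Sup K) - g (Inf K))) < \<epsilon>"
      by (rule absolutely_continuous_tagged_partial_division[OF ac \<open>\<epsilon> > 0\<close>]) (rule that)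
    \<comment> \<open>The bound \<open>\<delta>\<close> serves absolute continuity, the bound
      \<open>\<epsilon>\<close> the linear part.\<close>
    have "min \<delta> \<epsilon> > 0" using \<delta> \<open>\<epsilon> > 0\<close> by simp
    then obtain U where U: "open U" "E \<subseteq> U" "U \<in> lmeasurable" "measure lebesgue U < min \<delta> \<epsilon>"
      by (rule negligible_open_cover[OF E])
    \<comment> \<open>Radii for the gauge: at a point of \<open>E\<close> the ball has to stay in
      \<open>U\<close>, at any other point of the interval the straddle estimate has to hold, and
      elsewhere positivity suffices because a gauge is defined on the whole line.\<close>
    define good where "good s r \<longleftrightarrow> r > 0 \<and> (s \<in> E \<longrightarrow> ball s r \<subseteq> U) \<and>
      (s \<in> {a..b} - E \<longrightarrow> (\<forall>u v. u \<in> {a..b} \<longrightarrow> v \<in> {a..b} \<longrightarrow> u \<le> s \<longrightarrow> s \<le> v \<longrightarrow>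
         \<bar>u - s\<bar> < r \<longrightarrow> \<bar>v - s\<bar> < r \<longrightarrow> g v - g u \<le> (\<beta> + \<epsilon>) * (v - u)))" for s r
    have "\<exists>r. good s r" for s
    proof -
      consider "s \<in> E" | "s \<in> {a..b} - E" | "s \<notin> E" "s \<notin> {a..b}" by blast
      then show ?thesis
      proof cases
        case 1
        then have "s \<in> U" using U(2) by blast
        then obtain r where "r > 0" "ball s r \<subseteq> U" using openE[OF U(1)] by metis
        then show ?thesis using 1 unfolding good_def by blast
      next
        case 2
        then obtain d where d: "(g has_vector_derivative d) (at s within {a..b})" "d \<le> \<beta>"
          using der[of s] by auto
        obtain r where "r > 0" and r: "\<And>u v. u \<in> {a..b} \<Longrightarrow> v \<in> {a..b} \<Longrightarrow> u \<le> s \<Longrightarrow> s \<le> v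
            \<Longrightarrow> \<bar>u - s\<bar> < r \<Longrightarrow> \<bar>v - s\<bar> < r \<Longrightarrow> g v - g u \<le> (d + \<epsilon>) * (v - u)"
          by (rule real_derivative_straddle[OF d(1) \<open>\<epsilon> > 0\<close>]) (rule that)
        have "g v - g u \<le> (\<beta> + \<epsilon>) * (v - u)"
          if "u \<in> {a..b}" "v \<in> {a..b}" "u \<le> s" "s \<le> v" "\<bar>u - s\<bar> < r" "\<bar>v - s\<bar> < r" for u v
        proof -
          have "(d + \<epsilon>) * (v - u) \<le> (\<beta> + \<epsilon>) * (v - u)"
            using d(2) that by (intro mult_right_mono) auto
          then show ?thesis using r[OF that] by linarith
        qed
        then show ?thesis using 2 \<open>r > 0\<close> unfolding good_def by (intro exI[of _ r]) simp
      next
        case 3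
        then have "good s 1" unfolding good_def by auto
        then show ?thesis ..
      qed
    qed
    then have "\<forall>s. \<exists>r. good s r" ..
    from choice[OF this] obtain r where r: "good s (r s)" for s by blast
    have "gauge (\<lambda>s. ball s (r s))" using r by (intro gauge_ball_dependent) (simp add: good_def)
    then obtain p where p: "p tagged_division_of {a..b}" and fine: "(\<lambda>s. ball s (r s)) fine p"
      by (rule fine_division_exists_real)
    have p': "p tagged_partial_division_of {a..b}" using p by (simp add: tagged_division_of_def)
    have finp: "finite p" using p by auto
    note K = tagged_partial_division_real_interval[OF p']
    \<comment> \<open>Degenerate intervals tagged in \<open>E\<close> have zero increment, so they
      stay with the well-behaved ones.\<close>
    define q where "q = {(s, K) \<in> p. s \<in> E \<and> Inf K < Sup K}"
    have qp: "q \<subseteq> p" by (auto simp: q_def)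
    have q: "q tagged_partial_division_of {a..b}"
      using tagged_partial_division_subset[OF p' qp] .
    have sub: "K \<subseteq> ball s (r s)" if "(s, K) \<in> p" for s K
      using fine that unfolding fine_def by blast
    have len: "(\<Sum>(s, K)\<in>q. Sup K - Inf K) \<le> measure lebesgue U"
    proof (rule tagged_partial_division_length_le[OF q U(3)])
      fix s K assume "(s, K) \<in> q"
      then have "(s, K) \<in> p" "s \<in> E" by (auto simp: q_def)
      then show "K \<subseteq> U" using sub[of s K] r[of s] by (auto simp: good_def)
    qed
    have incr: "(\<Sum>(s, K)\<in>q. \<bar>g (Sup K) - g (Inf K)\<bar>) < \<epsilon>"
      using small[OF q] len U(4) by (auto simp: q_def)
    have outside: "g (Sup K) - g (Inf K) \<le> (\<beta> + \<epsilon>) * (Sup K - Inf K)"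
      if "(s, K) \<in> p" "(s, K) \<notin> q" for s K
    proof (cases "s \<in> E")
      case True
      then have "Inf K = Sup K" using that K(3,4)[OF that(1)] by (auto simp: q_def)
      then show ?thesis by simp
    next
      case False
      have "Inf K \<in> K" "Sup K \<in> K"
        using K(1,3,4)[OF that(1)] by (metis atLeastAtMost_iff order_refl order_trans)+
      then have "\<bar>Inf K - s\<bar> < r s" "\<bar>Sup K - s\<bar> < r s"
        using sub[OF that(1)] by (auto simp: dist_real_def)
      then show ?thesis
        using r[of s] K(2-5)[OF that(1)] False by (auto simp: good_def)
    qed
    define w where "w i = (case i of (s::real, K) \<Rightarrow>
        \<bar>g (Sup K) - g (Inf K)\<bar> + (\<bar>\<beta>\<bar> + \<epsilon>) * (Sup K - Inf K))" for i
    \<comment> \<open>Subtracting the linear function makes every term outside \<open>q\<close>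
      nonpositive, while the sum over the whole division telescopes.\<close>
    let ?h = "\<lambda>s. g s - (\<beta> + \<epsilon>) * s"
    have "?h b - ?h a = (\<Sum>(s, K)\<in>p. ?h (Sup K) - ?h (Inf K))"
      using additive_tagged_division_1[OF \<open>a \<le> b\<close> p, of ?h] by simp
    also have "\<dots> \<le> (\<Sum>i\<in>p. if i \<in> q then w i else 0)"
    proof (rule sum_mono)
      fix i assume "i \<in> p"
      obtain s K where i: "i = (s, K)" by fastforce
      have iK: "(s, K) \<in> p" using \<open>i \<in> p\<close> i by simp
      define c where "c = (\<beta> + \<epsilon>) * (Sup K - Inf K)"
      \<comment> \<open>The sign of \<open>\<beta>\<close> is unknown, hence the absolute value in
        \<open>w\<close>.\<close>
      have "- c \<le> (\<bar>\<beta>\<bar> + \<epsilon>) * (Sup K - Inf K)"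
        using K(3,4)[OF iK] \<open>\<epsilon> > 0\<close> unfolding c_def mult_minus_left[symmetric]
        by (intro mult_right_mono) auto
      then have "g (Sup K) - g (Inf K) - c \<le> (if i \<in> q then w i else 0)"
        using outside[OF iK] by (auto simp: i w_def c_def[symmetric])
      then show "(case i of (s, K) \<Rightarrow> ?h (Sup K) - ?h (Inf K)) \<le> (if i \<in> q then w i else 0)"
        by (simp add: i c_def algebra_simps)
    qed
    also have "\<dots> = (\<Sum>i\<in>q. w i)"
      using qp finp by (intro sum.mono_neutral_cong_right) auto
    also have "\<dots> = (\<Sum>(s, K)\<in>q. \<bar>g (Sup K) - g (Inf K)\<bar>) + (\<bar>\<beta>\<bar> + \<epsilon>) * (\<Sum>(s, K)\<in>q. Sup K - Inf K)"
      by (simp add: w_def case_prod_unfold sum.distrib sum_distrib_left)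
    also have "\<dots> \<le> \<epsilon> + (\<bar>\<beta>\<bar> + \<epsilon>) * \<epsilon>"
      using incr len U(4) \<open>\<epsilon> > 0\<close> by (intro add_mono mult_left_mono) auto
    finally show ?thesis by (simp add: algebra_simps)
  qed
  have "((\<lambda>\<epsilon>. (\<beta> + \<epsilon>) * (b - a) + \<epsilon> + (\<bar>\<beta>\<bar> + \<epsilon>) * \<epsilon>) \<longlongrightarrow> \<beta> * (b - a)) (at_right 0)"
    by (auto intro!: tendsto_eq_intros)
  moreover have "\<forall>\<^sub>F \<epsilon> in at_right 0. g b - g a \<le> (\<beta> + \<epsilon>) * (b - a) + \<epsilon> + (\<bar>\<beta>\<bar> + \<epsilon>) * \<epsilon>"
    using eventually_at_right_less by (rule eventually_mono) (rule approx)
  ultimately show ?thesis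
    by (rule tendsto_lowerbound) simp
qed

section \<open>From the scalar estimate to vector-valued functions\<close>

lemma absolutely_continuous_fun_on_subinterval:
  assumes "absolutely_continuous_fun_on a b x" "a \<le> a'" "b' \<le> b"
  shows "absolutely_continuous_fun_on a' b' x"
  unfolding absolutely_continuous_fun_on_def
proof (intro allI impI)
  fix \<epsilon> :: real assume "\<epsilon> > 0"
  note pos = this
  obtain \<delta> where "\<delta> > 0" and \<delta>: "\<And>D. \<lbrakk>finite D; \<forall>(u, v)\<in>D. a \<le> u \<and> u < v \<and> v \<le> b;
      disjoint_family_on (\<lambda>(u, v). {u<..<v}) D; (\<Sum>(u, v)\<in>D. v - u) < \<delta>\<rbrakk>
        \<Longrightarrow> (\<Sum>(u, v)\<in>D. norm (x v - x u)) < \<epsilon>"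
    by (rule absolutely_continuous_fun_onE[OF assms(1) pos]) (rule that)
  have "(\<Sum>(u, v)\<in>D. norm (x v - x u)) < \<epsilon>"
    if "finite D" "\<forall>(u, v)\<in>D. a' \<le> u \<and> u < v \<and> v \<le> b'"
      "disjoint_family_on (\<lambda>(u, v). {u<..<v}) D" "(\<Sum>(u, v)\<in>D. v - u) < \<delta>" for D
    using that assms(2,3) by (intro \<delta>) fastforce+
  then show "\<exists>\<delta>>0. \<forall>D. finite D \<longrightarrow> (\<forall>(u, v)\<in>D. a' \<le> u \<and> u < v \<and> v \<le> b') \<longrightarrow>
      disjoint_family_on (\<lambda>(u, v). {u<..<v}) D \<longrightarrow> (\<Sum>(u, v)\<in>D. v - u) < \<delta> \<longrightarrow>
      (\<Sum>(u, v)\<in>D. norm (x v - x u)) < \<epsilon>"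
    using \<open>\<delta> > 0\<close> by blast
qed

lemma absolutely_continuous_fun_on_inner_left:
  fixes x :: "real \<Rightarrow> 'a::real_inner"
  assumes "absolutely_continuous_fun_on a b x"
  shows "absolutely_continuous_fun_on a b (\<lambda>s. c \<bullet> x s)"
  unfolding absolutely_continuous_fun_on_def
proof (intro allI impI)
  fix \<epsilon> :: real assume "\<epsilon> > 0"
  \<comment> \<open>The added 1 keeps the quotient positive when \<open>c = 0\<close>.\<close>
  then have "\<epsilon> / (norm c + 1) > 0" by (simp add: add_nonneg_pos)
  note pos = this
  obtain \<delta> where "\<delta> > 0" and \<delta>: "\<And>D. \<lbrakk>finite D; \<forall>(u, v)\<in>D. a \<le> u \<and> u < v \<and> v \<le> b;
      disjoint_family_on (\<lambda>(u, v). {u<..<v}) D; (\<Sum>(u, v)\<in>D. v - u) < \<delta>\<rbrakk>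
        \<Longrightarrow> (\<Sum>(u, v)\<in>D. norm (x v - x u)) < \<epsilon> / (norm c + 1)"
    by (rule absolutely_continuous_fun_onE[OF assms(1) pos]) (rule that)
  have "(\<Sum>(u, v)\<in>D. norm (c \<bullet> x v - c \<bullet> x u)) < \<epsilon>"
    if "finite D" "\<forall>(u, v)\<in>D. a \<le> u \<and> u < v \<and> v \<le> b"
      "disjoint_family_on (\<lambda>(u, v). {u<..<v}) D" "(\<Sum>(u, v)\<in>D. v - u) < \<delta>" for D
  proof -
    have "norm (c \<bullet> x v - c \<bullet> x u) \<le> (norm c + 1) * norm (x v - x u)" for u v
    proof -
      have "norm (c \<bullet> x v - c \<bullet> x u) \<le> norm c * norm (x v - x u)"
        unfolding inner_diff_right[symmetric] real_norm_def by (rule Cauchy_Schwarz_ineq2)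
      also have "\<dots> \<le> (norm c + 1) * norm (x v - x u)" by (intro mult_right_mono) auto
      finally show ?thesis .
    qed
    then have "(\<Sum>(u, v)\<in>D. norm (c \<bullet> x v - c \<bullet> x u)) \<le> (norm c + 1) * (\<Sum>(u, v)\<in>D. norm (x v - x u))"
      unfolding sum_distrib_left case_prod_unfold by (intro sum_mono)
    also have "\<dots> < \<epsilon>"
      using \<delta>[OF that] by (simp add: pos_less_divide_eq add_nonneg_pos mult.commute)
    finally show ?thesis .
  qed
  then show "\<exists>\<delta>>0. \<forall>D. finite D \<longrightarrow> (\<forall>(u, v)\<in>D. a \<le> u \<and> u < v \<and> v \<le> b) \<longrightarrow>
      disjoint_family_on (\<lambda>(u, v). {u<..<v}) D \<longrightarrow> (\<Sum>(u, v)\<in>D. v - u) < \<delta> \<longrightarrow>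
      (\<Sum>(u, v)\<in>D. norm (c \<bullet> x v - c \<bullet> x u)) < \<epsilon>"
    using \<open>\<delta> > 0\<close> by blast
qed

text \<open>If the difference quotient were outside \<^term>\<open>K\<close>, a separating functional would contradict
  the scalar estimate.\<close>

lemma absolutely_continuous_mean_value:
  fixes x :: "real \<Rightarrow> 'a::euclidean_space"
  assumes ac: "absolutely_continuous_fun_on a b x" and "a < b" and E: "negligible E"
    and K: "convex K" "closed K"
    and der: "\<And>s. s \<in> {a..b} \<Longrightarrow> s \<notin> E \<Longrightarrow>
       \<exists>v. (x has_vector_derivative v) (at s within {a..b}) \<and> v \<in> K"
  shows "(x b - x a) /\<^sub>R (b - a) \<in> K"
proof (rule ccontr)
  assume "\<not> ?thesis"
  then obtain c \<beta> where c: "c \<bullet> ((x b - x a) /\<^sub>R (b - a)) < \<beta>" "\<And>v. v \<in> K \<Longrightarrow> c \<bullet> v > \<beta>"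
    using separating_hyperplane_closed_point[OF K] by metis
  \<comment> \<open>The functional is negated because separation bounds it from below on
    \<open>K\<close>, whereas the increment estimate takes upper bounds on the derivative.\<close>
  have "(- c) \<bullet> x b - (- c) \<bullet> x a \<le> (- \<beta>) * (b - a)"
  proof (rule absolutely_continuous_increment_le[OF absolutely_continuous_fun_on_inner_left[OF ac] _ E])
    fix s assume "s \<in> {a..b}" "s \<notin> E"
    then obtain v where v: "(x has_vector_derivative v) (at s within {a..b})" "v \<in> K"
      using der by blast
    have "((\<lambda>s. - c \<bullet> x s) has_vector_derivative (- c \<bullet> v)) (at s within {a..b})"
      by (rule bounded_linear.has_vector_derivative[OF bounded_linear_inner_right v(1)])
    moreover have "- c \<bullet> v \<le> - \<beta>" using c(2)[OF v(2)] by simp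
    ultimately show "\<exists>d. ((\<lambda>s. - c \<bullet> x s) has_vector_derivative d) (at s within {a..b}) \<and> d \<le> - \<beta>"
      by blast
  qed (use \<open>a < b\<close> in simp)
  then have "\<beta> * (b - a) \<le> c \<bullet> (x b - x a)" by (simp add: inner_diff_right)
  moreover have "c \<bullet> (x b - x a) < \<beta> * (b - a)"
    using c(1) \<open>a < b\<close> by (simp add: divide_simps mult.commute)
  ultimately show False by simp
qed

text \<open>Extracts the null set from the inclusion and restricts the derivative to the
  subinterval. What remains for an application is a closed convex set that contains the right-hand
  side along the solution.\<close>

lemma di_solution_mean_value:
  fixes x :: "real \<Rightarrow> 'a::euclidean_space"
  assumes sol: "di_solution T F x0 x" and ab: "0 \<le> a" "a < b" "b \<le> T"
    and K: "convex K" "closed K" and sub: "\<And>s. s \<in> {a..b} \<Longrightarrow> F s (x s) \<subseteq> K"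
  shows "(x b - x a) /\<^sub>R (b - a) \<in> K"
proof -
  have "AE s in lebesgue_on {0..T}. \<exists>v. (x has_vector_derivative v) (at s within {0..T}) \<and> v \<in> F s (x s)"
    and ac: "absolutely_continuous_fun_on 0 T x"
    using sol by (auto simp: di_solution_def)
  then obtain E where E: "negligible E" and der: "\<And>s. s \<in> {0..T} \<Longrightarrow> s \<notin> E \<Longrightarrow>
      \<exists>v. (x has_vector_derivative v) (at s within {0..T}) \<and> v \<in> F s (x s)"
    by (elim AE_lebesgue_on_negligible) auto
  show ?thesis
  proof (rule absolutely_continuous_mean_value[OF _ ab(2) E K])
    show "absolutely_continuous_fun_on a b x"
      using absolutely_continuous_fun_on_subinterval[OF ac] ab by simp
    fix s assume s: "s \<in> {a..b}" "s \<notin> E"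
    then obtain v where "(x has_vector_derivative v) (at s within {0..T})" "v \<in> F s (x s)"
      using der[of s] ab by auto
    then show "\<exists>v. (x has_vector_derivative v) (at s within {a..b}) \<and> v \<in> K"
      using sub[OF s(1)] ab by (intro exI[of _ v]) (auto intro: has_vector_derivative_within_subset)
  qed
qed


section \<open>Set distances\<close>

text \<open>Compactness of \<open>A\<close> bounds the distances from above, so the real supremum in
  \<open>excess\<close> really is an upper bound.\<close>

lemma infdist_le_excess:
  assumes "compact A" "a \<in> A"
  shows "infdist a B \<le> excess A B"
  unfolding excess_def
proof (rule cSUP_upper[OF assms(2)])
  have "continuous_on A (\<lambda>a. infdist a B)" by (rule continuous_on_infdist[OF continuous_on_id])
  then show "bdd_above ((\<lambda>a. infdist a B) ` A)"
    by (rule bounded_imp_bdd_above[OF compact_imp_bounded[OF compact_continuous_image[OF _ assms(1)]]])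
qed

text \<open>Selection form of the excess: a nearest point of the compact set \<open>B\<close> serves
  as \<open>b\<close>.\<close>

lemma excess_attains:
  fixes B :: "'a::heine_borel set"
  assumes "compact A" "a \<in> A" "compact B" "B \<noteq> {}"
  obtains b where "b \<in> B" "dist a b \<le> excess A B"
proof -
  obtain b where "b \<in> B" "infdist a B = dist a b"
    using infdist_attains_inf[of B a] compact_imp_closed assms by auto
  then show ?thesis using infdist_le_excess[OF assms(1,2), of B] that by simp
qed

lemma norm_le_set_norm:
  assumes "compact A" "a \<in> A"
  shows "norm a \<le> set_norm A"
  unfolding set_norm_def
proof (rule cSUP_upper[OF assms(2)])
  show "bdd_above (norm ` A)"
    by (rule bounded_imp_bdd_above[OF compact_imp_bounded[OF
          compact_continuous_image[OF continuous_on_norm_id assms(1)]]])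
qed

text \<open>Each point of \<open>A\<close> is within \<open>excess A B\<close> of a point of
  \<open>B\<close>, whose norm is at most \<open>set_norm B\<close>.\<close>

lemma set_norm_le_add_excess:
  fixes A B :: "'a::{real_normed_vector, heine_borel} set"
  assumes "compact A" "A \<noteq> {}" "compact B" "B \<noteq> {}"
  shows "set_norm A \<le> set_norm B + excess A B"
  unfolding set_norm_def[of A]
proof (rule cSUP_least[OF assms(2)])
  fix a assume "a \<in> A"
  then obtain b where b: "b \<in> B" "dist a b \<le> excess A B"
    using excess_attains assms by metis
  have "norm a \<le> norm b + dist a b" by (metis dist_norm norm_triangle_sub)
  then show "norm a \<le> set_norm B + excess A B"
    using b norm_le_set_norm[OF assms(3) b(1)] by simp
qed

lemma abs_set_norm_diff_le_hausdorff_dist: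
  fixes A B :: "'a::{real_normed_vector, heine_borel} set"
  assumes "compact A" "A \<noteq> {}" "compact B" "B \<noteq> {}"
  shows "\<bar>set_norm A - set_norm B\<bar> \<le> hausdorff_dist A B"
  using set_norm_le_add_excess[of A B] set_norm_le_add_excess[of B A] assms
  by (auto simp: hausdorff_dist_def)

text \<open>A crude bound, used to see that the set whose supremum defines \<open>tau_M\<close> is
  bounded above.\<close>

lemma excess_le_set_norm_add:
  assumes "compact A" "A \<noteq> {}" "compact B" "B \<noteq> {}"
  shows "excess A B \<le> set_norm A + set_norm B"
  unfolding excess_def
proof (rule cSUP_least[OF assms(2)])
  fix a assume a: "a \<in> A"
  obtain b where b: "b \<in> B" using assms by blast
  have "infdist a B \<le> dist a b" using b by (rule infdist_le)
  also have "\<dots> \<le> norm a + norm b" by (simp add: dist_norm norm_triangle_ineq4)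
  finally show "infdist a B \<le> set_norm A + set_norm B"
    using norm_le_set_norm[OF assms(1) a] norm_le_set_norm[OF assms(3) b] by simp
qed

text \<open>On nonempty compact sets \<open>set_norm\<close> is 1-Lipschitz for the Hausdorff
  distance, so continuity of \<open>F\<close> carries over. On a compact domain this makes the
  values of \<open>M\<close> uniformly bounded.\<close>

lemma continuous_on_set_norm:
  fixes F :: "'b::topological_space \<Rightarrow> 'a::{real_normed_vector, heine_borel} set"
  assumes "hausdorff_continuous_on S F" "\<And>p. p \<in> S \<Longrightarrow> F p \<noteq> {} \<and> compact (F p)"
  shows "continuous_on S (\<lambda>p. set_norm (F p))"
  unfolding continuous_on_def
proof
  fix p assume p: "p \<in> S"
  show "((\<lambda>q. set_norm (F q)) \<longlongrightarrow> set_norm (F p)) (at p within S)"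
  proof (rule Lim_transform2)
    show "((\<lambda>q. set_norm (F p)) \<longlongrightarrow> set_norm (F p)) (at p within S)" by simp
    have "((\<lambda>q. hausdorff_dist (F q) (F p)) \<longlongrightarrow> 0) (at p within S)"
      using assms(1) p by (auto simp: hausdorff_continuous_on_def)
    moreover have "\<forall>\<^sub>F q in at p within S. norm (set_norm (F p) - set_norm (F q)) \<le> hausdorff_dist (F q) (F p)"
      unfolding eventually_at_topological
      using abs_set_norm_diff_le_hausdorff_dist assms(2) p
      by (metis UNIV_I abs_minus_commute open_UNIV real_norm_def)
    ultimately show "((\<lambda>q. set_norm (F p) - set_norm (F q)) \<longlongrightarrow> 0) (at p within S)"
      by (rule Lim_null_comparison[rotated])
  qed
qed


section \<open>The implicit step\<close>

text \<open>The range is closed by the expansion estimate and open by invariance of domain.\<close>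

lemma strongly_monotone_surj:
  fixes G :: "'a::euclidean_space \<Rightarrow> 'a"
  assumes cont: "continuous_on UNIV G" and "c > 0"
    and mono: "\<And>z z'. (G z - G z') \<bullet> (z - z') \<ge> c * (norm (z - z'))\<^sup>2"
  shows "surj G"
proof -
  \<comment> \<open>By Cauchy-Schwarz, monotonicity becomes expansion, which yields both injectivity
    and the closed range.\<close>
  have expand: "c * norm (z - z') \<le> norm (G z - G z')" for z z'
  proof (cases "z = z'")
    case False
    have "c * norm (z - z') * norm (z - z') \<le> norm (G z - G z') * norm (z - z')"
      using order_trans[OF mono[of z z'] norm_cauchy_schwarz] by (simp add: power2_eq_square mult.assoc)
    then show ?thesis using False by simp
  qed simp
  have inj: "inj G"
  proof (rule injI)
    fix z z' assume "G z = G z'"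
    then have "c * norm (z - z') \<le> 0" using expand[of z z'] by simp
    then show "z = z'" using \<open>c > 0\<close> by (simp add: mult_le_0_iff)
  qed
  have "open (range G)" using invariance_of_domain[OF cont _ inj] by simp
  moreover have "closed (range G)"
    unfolding closed_sequential_limits
  proof (intro allI impI, elim conjE)
    fix w l assume "\<forall>n::nat. w n \<in> range G" and lim: "w \<longlonglongrightarrow> l"
    then have "\<forall>n. \<exists>z. w n = G z" by blast
    then obtain z where z: "\<And>n. w n = G (z n)" by metis
    \<comment> \<open>Expansion makes preimages of a convergent sequence Cauchy; their limit is
      mapped to \<open>l\<close> by continuity.\<close>
    have "Cauchy z"
    proof (rule metric_CauchyI)
      fix e :: real assume "e > 0"
      then obtain k where k: "\<And>m n. m \<ge> k \<Longrightarrow> n \<ge> k \<Longrightarrow> dist (w m) (w n) < c * e"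
        using metric_CauchyD[OF LIMSEQ_imp_Cauchy[OF lim], of "c * e"] \<open>c > 0\<close> by auto
      have "dist (z m) (z n) < e" if "m \<ge> k" "n \<ge> k" for m n
      proof -
        have "c * dist (z m) (z n) < c * e"
          using k[OF that] expand[of "z m" "z n"] by (simp add: z dist_norm)
        then show ?thesis using \<open>c > 0\<close> by simp
      qed
      then show "\<exists>k. \<forall>m\<ge>k. \<forall>n\<ge>k. dist (z m) (z n) < e" by blast
    qed
    then obtain z0 where "z \<longlonglongrightarrow> z0" using Cauchy_convergent convergent_def by blast
    then have "w \<longlonglongrightarrow> G z0"
      using cont unfolding z by (simp add: continuous_on_tendsto_compose)
    then show "l \<in> range G" using lim LIMSEQ_unique by blast
  qed
  ultimately show ?thesis using clopen by blast
qed

text \<open>The map sending \<open>z\<close> to \<open>z - h *\<^sub>R \<phi> z\<close> is strongly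
  monotone with constant \<open>1 - l * h\<close>, which the step restriction makes positive; so it
  attains the value \<open>w\<close>.\<close>

lemma implicit_step_solvable:
  fixes \<phi> :: "'a::euclidean_space \<Rightarrow> 'a"
  assumes cont: "continuous_on UNIV \<phi>" and "h > 0" "l * h < 1"
    and osl: "\<And>z z'. (\<phi> z - \<phi> z') \<bullet> (z - z') \<le> l * (norm (z - z'))\<^sup>2"
  shows "\<exists>z. z = w + h *\<^sub>R \<phi> z"
proof -
  have "surj (\<lambda>z. z - h *\<^sub>R \<phi> z)"
  proof (rule strongly_monotone_surj)
    show "continuous_on UNIV (\<lambda>z. z - h *\<^sub>R \<phi> z)" by (intro continuous_intros cont)
    show "1 - l * h > 0" using assms by simp
    fix z z'
    have "h * ((\<phi> z - \<phi> z') \<bullet> (z - z')) \<le> h * (l * (norm (z - z'))\<^sup>2)"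
      using osl \<open>h > 0\<close> by (intro mult_left_mono) auto
    moreover have "(z - h *\<^sub>R \<phi> z - (z' - h *\<^sub>R \<phi> z')) \<bullet> (z - z')
        = (norm (z - z'))\<^sup>2 - h * ((\<phi> z - \<phi> z') \<bullet> (z - z'))"
      by (simp add: power2_norm_eq_inner inner_diff_left algebra_simps)
    ultimately show "(1 - l * h) * (norm (z - z'))\<^sup>2 \<le> (z - h *\<^sub>R \<phi> z - (z' - h *\<^sub>R \<phi> z')) \<bullet> (z - z')"
      by (simp add: algebra_simps)
  qed
  then obtain z where "w = z - h *\<^sub>R \<phi> z" by (meson surjD)
  then show ?thesis by (metis diff_add_cancel)
qed

text \<open>Testing the difference of the two equations with \<open>z - z'\<close> gives
  \<open>(1 - l * h) * norm (z - z') \<le> norm (w - w')\<close>. The inverse factor equals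
  \<open>1 + l * h / (1 - l * h)\<close>, and bounding it by an exponential gives the form that
  multiplies well over many steps.\<close>

lemma implicit_step_stability:
  fixes \<phi> :: "'a::real_inner \<Rightarrow> 'a"
  assumes "h > 0" "l * h < 1"
    and osl: "\<And>z z'. (\<phi> z - \<phi> z') \<bullet> (z - z') \<le> l * (norm (z - z'))\<^sup>2"
    and z: "z = w + h *\<^sub>R \<phi> z" and z': "z' = w' + h *\<^sub>R \<phi> z'"
  shows "norm (z - z') \<le> exp (l * h / (1 - l * h)) * norm (w - w')"
proof -
  have "z - z' = (w - w') + h *\<^sub>R (\<phi> z - \<phi> z')"
    using z z' by (simp add: algebra_simps)
  then have "(norm (z - z'))\<^sup>2 = (w - w') \<bullet> (z - z') + h * ((\<phi> z - \<phi> z') \<bullet> (z - z'))"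
    by (metis inner_add_left inner_scaleR_left power2_norm_eq_inner)
  also have "\<dots> \<le> norm (w - w') * norm (z - z') + h * (l * (norm (z - z'))\<^sup>2)"
    using osl \<open>h > 0\<close> by (intro add_mono norm_cauchy_schwarz mult_left_mono) auto
  finally have "(1 - l * h) * norm (z - z') * norm (z - z') \<le> norm (w - w') * norm (z - z')"
    by (simp add: power2_eq_square algebra_simps)
  then have "(1 - l * h) * norm (z - z') \<le> norm (w - w')"
    by (cases "z = z'") auto
  then have "norm (z - z') \<le> (1 + l * h / (1 - l * h)) * norm (w - w')"
    using \<open>l * h < 1\<close> by (simp add: field_simps)
  also have "\<dots> \<le> exp (l * h / (1 - l * h)) * norm (w - w')"
    by (intro mult_right_mono exp_ge_add_one_self) auto
  finally show ?thesis .
qed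

text \<open>Discrete variation of constants. The sum over \<open>b\<close> starts at
  \<open>Suc k\<close>, because the contribution \<open>c k\<close> enters its own step after the
  factor \<open>exp (b k)\<close> and before the factor \<open>exp (a k)\<close>.\<close>

lemma sum_variation_of_constants_Suc:
  fixes a b c :: "nat \<Rightarrow> real"
  shows "(\<Sum>k<Suc n. exp (sum a {k..<Suc n} + sum b {Suc k..<Suc n}) * c k)
    = exp (a n) * (exp (b n) * (\<Sum>k<n. exp (sum a {k..<n} + sum b {Suc k..<n}) * c k) + c n)"
proof -
  have "exp (sum a {k..<Suc n} + sum b {Suc k..<Suc n})
      = exp (a n) * (exp (b n) * exp (sum a {k..<n} + sum b {Suc k..<n}))" if "k < n" for k
    using that by (simp add: exp_add[symmetric] algebra_simps)
  then have "(\<Sum>k<n. exp (sum a {k..<Suc n} + sum b {Suc k..<Suc n}) * c k)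
      = (\<Sum>k<n. exp (a n) * (exp (b n) * (exp (sum a {k..<n} + sum b {Suc k..<n}) * c k)))"
    by (intro sum.cong) (auto simp: mult.assoc)
  then show ?thesis by (simp add: sum_distrib_left algebra_simps)
qed


section \<open>Error of the scheme along a solution\<close>

lemma continuous_on_compact_Times_bound:
  fixes \<phi> :: "'a::metric_space \<Rightarrow> 'b::metric_space \<Rightarrow> 'c::real_normed_vector"
  assumes "compact S" "compact S'" "continuous_on (S \<times> S') (\<lambda>(s, z). \<phi> s z)"
  obtains B where "\<And>s z. s \<in> S \<Longrightarrow> z \<in> S' \<Longrightarrow> norm (\<phi> s z) \<le> B"
proof -
  obtain B where B: "\<And>p. p \<in> S \<times> S' \<Longrightarrow> norm (case p of (s, z) \<Rightarrow> \<phi> s z) \<le> B"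
    using continuous_on_compact_bound[OF compact_Times[OF assms(1,2)] assms(3)] by metis
  show ?thesis by (rule that[of B]) (use B in force)
qed

lemma norm_diff_le_tau_f:
  fixes f :: "real \<Rightarrow> 'a::euclidean_space \<Rightarrow> 'a"
  assumes cont: "continuous_on ({0..T} \<times> cball 0 C) (\<lambda>(s, z). f s z)"
    and "s \<in> {0..T}" "s' \<in> {0..T}" "\<bar>s - s'\<bar> \<le> \<delta>" "z \<in> cball 0 C"
  shows "norm (f s z - f s' z) \<le> tau_f T C f \<delta>"
proof -
  obtain B where B: "norm (f s z) \<le> B" if "s \<in> {0..T}" "z \<in> cball 0 C" for s z
    by (rule continuous_on_compact_Times_bound[OF compact_Icc compact_cball cont]) (rule that)
  show ?thesis
    unfolding tau_f_def
  proof (rule cSup_upper)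
    show "bdd_above {norm (f t x - f t' x) | t t' x.
        t \<in> {0..T} \<and> t' \<in> {0..T} \<and> \<bar>t - t'\<bar> \<le> \<delta> \<and> x \<in> cball 0 C}"
      by (rule bdd_aboveI[of _ "B + B"])
        (clarify, intro order_trans[OF norm_triangle_ineq4] add_mono B)
  qed (use assms in blast)
qed

lemma norm_diff_le_chi_f:
  fixes f :: "real \<Rightarrow> 'a::euclidean_space \<Rightarrow> 'a"
  assumes cont: "continuous_on ({0..T} \<times> cball 0 C) (\<lambda>(s, z). f s z)"
    and "s \<in> {0..T}" "z \<in> cball 0 C" "z' \<in> cball 0 C" "norm (z - z') \<le> \<delta>"
  shows "norm (f s z - f s z') \<le> chi_f T C f \<delta>"
proof -
  obtain B where B: "norm (f s z) \<le> B" if "s \<in> {0..T}" "z \<in> cball 0 C" for s z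
    by (rule continuous_on_compact_Times_bound[OF compact_Icc compact_cball cont]) (rule that)
  show ?thesis
    unfolding chi_f_def
  proof (rule cSup_upper)
    show "bdd_above {norm (f t x - f t x') | t x x'.
        t \<in> {0..T} \<and> x \<in> cball 0 C \<and> x' \<in> cball 0 C \<and> norm (x - x') \<le> \<delta>}"
      by (rule bdd_aboveI[of _ "B + B"])
        (clarify, intro order_trans[OF norm_triangle_ineq4] add_mono B)
  qed (use assms in blast)
qed

locale differential_inclusion =
  fixes f :: "real \<Rightarrow> 'a::euclidean_space \<Rightarrow> 'a"
    and M :: "real \<Rightarrow> 'a \<Rightarrow> 'a set"
    and L_M :: "real \<Rightarrow> real"
    and T C :: real
  assumes f_cont: "continuous_on ({0..T} \<times> UNIV) (\<lambda>(s, z). f s z)"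
    and M_values: "\<And>s z. s \<in> {0..T} \<Longrightarrow> M s z \<noteq> {} \<and> convex (M s z) \<and> compact (M s z)"
    and M_cont: "hausdorff_continuous_on ({0..T} \<times> UNIV) (\<lambda>(s, z). M s z)"
    and L_M_nonneg: "\<And>s. s \<in> {0..T} \<Longrightarrow> L_M s \<ge> 0"
    and M_lipschitz: "\<And>s z z'. s \<in> {0..T} \<Longrightarrow>
        hausdorff_dist (M s z) (M s z') \<le> L_M s * norm (z - z')"
begin

lemma f_cont_cball: "continuous_on ({0..T} \<times> cball 0 C) (\<lambda>(s, z). f s z)"
  by (rule continuous_on_subset[OF f_cont]) auto

lemma set_norm_cont_cball: "continuous_on ({0..T} \<times> cball 0 C) (\<lambda>(s, z). set_norm (M s z))"
proof -
  have "continuous_on ({0..T} \<times> UNIV) (\<lambda>p. set_norm ((\<lambda>(s, z). M s z) p))"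
    by (rule continuous_on_set_norm[OF M_cont]) (use M_values in auto)
  then show ?thesis
    by (rule continuous_on_subset[THEN continuous_on_cong[THEN iffD1, rotated -1]]) auto
qed

lemma excess_le_tau_M:
  assumes "s \<in> {0..T}" "s' \<in> {0..T}" "\<bar>s - s'\<bar> \<le> \<delta>" "z \<in> cball 0 C"
  shows "excess (M s z) (M s' z) \<le> tau_M T C M \<delta>"
proof -
  obtain B where B: "norm (set_norm (M s z)) \<le> B" if "s \<in> {0..T}" "z \<in> cball 0 C" for s z
    by (rule continuous_on_compact_Times_bound[OF compact_Icc compact_cball set_norm_cont_cball])
      (rule that)
  have "excess (M s z) (M s' z) \<le> B + B" if "s \<in> {0..T}" "s' \<in> {0..T}" "z \<in> cball 0 C" for s s' z
    using excess_le_set_norm_add[of "M s z" "M s' z"] M_values[of s z] M_values[of s' z]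
      B[of s z] B[of s' z] that by auto
  then have "bdd_above {excess (M t x) (M t' x) | t t' x.
      t \<in> {0..T} \<and> t' \<in> {0..T} \<and> \<bar>t - t'\<bar> \<le> \<delta> \<and> x \<in> cball 0 C}"
    by (intro bdd_aboveI[of _ "B + B"]) blast
  then show ?thesis
    unfolding tau_M_def by (rule cSup_upper[rotated]) (use assms in blast)
qed

text \<open>The norm of \<open>f\<close> and the set norm of \<open>M\<close> are continuous on a
  compact set, so both suprema in \<open>bound_P\<close> are finite and dominate the two summands of
  \<open>v\<close>.\<close>

lemma norm_rhs_le_bound_P:
  assumes "s \<in> {0..T}" "z \<in> cball 0 C" "v \<in> perturbed_rhs f M s z"
  shows "norm v \<le> bound_P T C f M"
proof -
  obtain m where m: "m \<in> M s z" "v = f s z + m"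
    using assms(3) by (auto simp: perturbed_rhs_def)
  have upper: "\<phi> (s, z) \<le> (SUP p\<in>{0..T} \<times> cball 0 C. \<phi> p)"
    if "continuous_on ({0..T} \<times> cball 0 C) \<phi>" for \<phi> :: "real \<times> 'a \<Rightarrow> real"
    by (rule cSUP_upper) (use assms that in \<open>auto intro!: bounded_imp_bdd_above compact_imp_bounded
      compact_continuous_image compact_Times\<close>)
  have "norm m \<le> set_norm (M s z)"
    using norm_le_set_norm m(1) M_values assms(1) by blast
  also have "\<dots> \<le> (SUP (s, z)\<in>{0..T} \<times> cball 0 C. set_norm (M s z))"
    using upper[OF set_norm_cont_cball] by simp
  finally have "norm m \<le> (SUP (s, z)\<in>{0..T} \<times> cball 0 C. set_norm (M s z))" .
  moreover have "norm (f s z) \<le> (SUP (s, z)\<in>{0..T} \<times> cball 0 C. norm (f s z))"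
    using upper[OF continuous_on_norm[OF f_cont_cball]] by (simp add: case_prod_unfold)
  ultimately show ?thesis
    unfolding m(2) bound_P_def by (intro norm_triangle_le) linarith
qed

section \<open>Estimates along a fixed solution that stays in the ball\<close>

context
  fixes x :: "real \<Rightarrow> 'a" and x0 :: 'a
  assumes solution: "di_solution T (perturbed_rhs f M) x0 x"
    and in_ball: "\<And>s. s \<in> {0..T} \<Longrightarrow> x s \<in> cball 0 C"
begin

text \<open>All velocities along the solution lie in the closed ball of radius
  \<open>bound_P T C f M\<close>, so the mean value theorem puts the difference quotient there
  too.\<close>

lemma solution_lipschitz:
  assumes "0 \<le> a" "a \<le> b" "b \<le> T"
  shows "norm (x b - x a) \<le> bound_P T C f M * (b - a)"
proof (cases "a = b")
  case False
  then have "a < b" using assms by simp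
  have "(x b - x a) /\<^sub>R (b - a) \<in> cball 0 (bound_P T C f M)"
  proof (rule di_solution_mean_value[OF solution assms(1) \<open>a < b\<close> assms(3)])
    fix s assume "s \<in> {a..b}"
    then have "s \<in> {0..T}" using assms by auto
    from norm_rhs_le_bound_P[OF this in_ball[OF this]]
    show "perturbed_rhs f M s (x s) \<subseteq> cball 0 (bound_P T C f M)" by auto
  qed auto
  then show ?thesis
    using \<open>a < b\<close> by (simp add: divide_simps mult.commute)
qed simp

text \<open>The mean value theorem is applied to the sum of \<open>M a y\<close> and a ball around
  \<open>f b (x b)\<close>. Taking \<open>M\<close> at an arbitrary \<open>y\<close> instead of
  \<open>x a\<close> lets the numerical iterate reuse the same \<open>m\<close>.\<close>

lemma solution_implicit_step:
  assumes ab: "0 \<le> a" "a < b" "b \<le> T"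
  obtains m where "m \<in> M a y"
    "norm (x b - (x a + (b - a) *\<^sub>R (f b (x b) + m)))
       \<le> (b - a) * (local_error T C f M L_M (b - a) a + L_M a * norm (x a - y))"
proof -
  define h where "h = b - a"
  define P where "P = bound_P T C f M"
  \<comment> \<open>The local error covers moving \<open>f\<close> and \<open>M\<close> in time and
    state along the solution; the last term covers moving the argument of \<open>M\<close> from
    \<open>x a\<close> to \<open>y\<close>.\<close>
  define \<rho> where "\<rho> = local_error T C f M L_M h a + L_M a * norm (x a - y)"
  \<comment> \<open>The sum of two sets is written as a double union, the shape of the library facts
    on its convexity and compactness.\<close>
  define K where "K = (\<Union>m\<in>M a y. \<Union>e\<in>cball (f b (x b)) \<rho>. {m + e})"
  have a: "a \<in> {0..T}" and b: "b \<in> {0..T}" using ab by auto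
  have K: "convex K" "closed K"
    using M_values[OF a, of y] unfolding K_def
    by (simp_all only: convex_sums[OF _ convex_cball] compact_imp_closed[OF compact_sums'[OF _ compact_cball]])
  have near: "\<exists>m'\<in>M a z'. dist m m' \<le> L_M a * norm (z - z')" if m: "m \<in> M a z" for m z z'
  proof -
    obtain m' where "m' \<in> M a z'" "dist m m' \<le> excess (M a z) (M a z')"
      using excess_attains[OF _ m, of "M a z'"] M_values[OF a] by blast
    then show ?thesis
      using M_lipschitz[OF a, of z z'] by (intro bexI[of _ m']) (auto simp: hausdorff_dist_def)
  qed
  have "(x b - x a) /\<^sub>R (b - a) \<in> K"
  proof (rule di_solution_mean_value[OF solution ab K])
    fix s assume s': "s \<in> {a..b}"
    then have s: "s \<in> {0..T}" using ab by auto
    show "perturbed_rhs f M s (x s) \<subseteq> K"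
    proof
      fix v assume "v \<in> perturbed_rhs f M s (x s)"
      then obtain m where m: "m \<in> M s (x s)" "v = f s (x s) + m"
        by (auto simp: perturbed_rhs_def)
      have xs: "x s \<in> cball 0 C" "x b \<in> cball 0 C" using in_ball s b by auto
      have "P * (s - a) \<le> P * h" "P * (b - s) \<le> P * h"
      proof -
        \<comment> \<open>\<open>P\<close> is nonnegative because it bounds a norm over an interval
          of positive length.\<close>
        have "P * h \<ge> 0"
          using order_trans[OF norm_ge_zero solution_lipschitz[of a b]] ab by (simp add: P_def h_def)
        then have "P \<ge> 0" using ab by (simp add: h_def zero_le_mult_iff)
        then show "P * (s - a) \<le> P * h" "P * (b - s) \<le> P * h"
          using s' by (auto simp: h_def intro!: mult_left_mono)
      qed
      \<comment> \<open>Distances to both ends are needed: \<open>M\<close> is frozen at the left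
        end and \<open>f\<close> at the right end.\<close>
      then have xd: "norm (x s - x a) \<le> P * h" "norm (x s - x b) \<le> P * h"
        using solution_lipschitz[of a s] solution_lipschitz[of s b] s' ab
        by (auto simp: P_def norm_minus_commute)
      \<comment> \<open>Successive nearest points lead from \<open>M s (x s)\<close> through
        \<open>M a (x s)\<close> and \<open>M a (x a)\<close> to \<open>M a y\<close>.\<close>
      obtain m1 where m1: "m1 \<in> M a (x s)" "dist m m1 \<le> excess (M s (x s)) (M a (x s))"
        using excess_attains[OF _ m(1), of "M a (x s)"] M_values[OF a] M_values[OF s] by blast
      have "dist m m1 \<le> tau_M T C M h"
        using m1(2) excess_le_tau_M[OF s a _ xs(1), of h] s' by (simp add: h_def)
      moreover obtain m2 where m2: "m2 \<in> M a (x a)" "dist m1 m2 \<le> L_M a * norm (x s - x a)"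
        using near[OF m1(1)] by blast
      moreover obtain m3 where m3: "m3 \<in> M a y" "dist m2 m3 \<le> L_M a * norm (x a - y)"
        using near[OF m2(1)] by blast
      moreover have "L_M a * norm (x s - x a) \<le> L_M a * (P * h)"
        using xd L_M_nonneg[OF a] by (intro mult_left_mono)
      moreover have "dist m m3 \<le> dist m m1 + dist m1 m2 + dist m2 m3"
        using dist_triangle[of m m3 m1] dist_triangle[of m1 m3 m2] by linarith
      ultimately have "norm (m - m3) \<le> tau_M T C M h + L_M a * (P * h) + L_M a * norm (x a - y)"
        by (simp add: dist_norm)
      moreover have "norm (f s (x s) - f b (x s)) \<le> tau_f T C f h"
        using norm_diff_le_tau_f[OF f_cont_cball s b _ xs(1)] s' by (simp add: h_def)
      moreover have "norm (f b (x s) - f b (x b)) \<le> chi_f T C f (P * h)"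
        using norm_diff_le_chi_f[OF f_cont_cball b xs xd(2)] .
      moreover have "v - m3 - f b (x b) = (f s (x s) - f b (x s)) + (f b (x s) - f b (x b)) + (m - m3)"
        by (simp add: m(2))
      then have "norm (v - m3 - f b (x b)) \<le> norm (f s (x s) - f b (x s)) + norm (f b (x s) - f b (x b)) + norm (m - m3)"
        by (metis norm_triangle_le norm_triangle_ineq add_right_mono)
      ultimately have "norm (v - m3 - f b (x b)) \<le> \<rho>"
        by (simp add: \<rho>_def local_error_def P_def[symmetric] mult.assoc)
      then have "v - m3 \<in> cball (f b (x b)) \<rho>" by (simp add: dist_norm norm_minus_commute)
      then show "v \<in> K" unfolding K_def using m3(1) by (intro UN_I[of m3] UN_I[of "v - m3"]) simp_all
    qed
  qed
  then obtain m e where me: "m \<in> M a y" "e \<in> cball (f b (x b)) \<rho>" "(x b - x a) /\<^sub>R h = m + e"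
    unfolding K_def h_def by blast
  have "h > 0" using ab by (simp add: h_def)
  have "x b - x a = h *\<^sub>R ((x b - x a) /\<^sub>R h)" using \<open>h > 0\<close> by simp
  also have "\<dots> = h *\<^sub>R (m + e)" by (simp only: me(3))
  finally have "x b - (x a + h *\<^sub>R (f b (x b) + m)) = h *\<^sub>R (e - f b (x b))"
    by (simp add: algebra_simps)
  then have "norm (x b - (x a + h *\<^sub>R (f b (x b) + m))) = h * norm (e - f b (x b))"
    using \<open>h > 0\<close> by simp
  also have "\<dots> \<le> h * \<rho>"
    using me(2) \<open>h > 0\<close> by (intro mult_left_mono) (auto simp: dist_norm norm_minus_commute)
  finally show ?thesis using that me(1) by (simp add: h_def \<rho>_def)
qed

text \<open>One step of the error recursion: stability of the implicit equation supplies the outer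
  exponential, and \<open>1 + L_M a * h \<le> exp (L_M a * h)\<close> the inner one.\<close>

lemma euler_step_error:
  assumes ab: "0 \<le> a" "a < b" "b \<le> T"
    and osl: "\<And>z z'. (f b z - f b z') \<bullet> (z - z') \<le> l * (norm (z - z'))\<^sup>2" and l: "l * (b - a) < 1"
  shows "\<exists>z\<in>semi_implicit_euler f M a y (b - a). norm (x b - z) \<le>
    exp (l * (b - a) / (1 - l * (b - a))) *
      (exp (L_M a * (b - a)) * norm (x a - y) + (b - a) * local_error T C f M L_M (b - a) a)"
proof -
  define h where "h = b - a"
  have h: "h > 0" using ab by (simp add: h_def)
  obtain m where m: "m \<in> M a y" and err: "norm (x b - (x a + h *\<^sub>R (f b (x b) + m)))
       \<le> h * (local_error T C f M L_M h a + L_M a * norm (x a - y))"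
    using solution_implicit_step[OF ab] unfolding h_def by blast
  have "continuous_on UNIV (f b)"
    using continuous_on_compose2[OF f_cont continuous_on_Pair[OF continuous_on_const[of UNIV b]
          continuous_on_id]] ab by (simp add: subset_iff image_iff)
  then obtain z where z: "z = (y + h *\<^sub>R m) + h *\<^sub>R f b z"
    using implicit_step_solvable[OF _ h _ osl, of "y + h *\<^sub>R m"] l by (auto simp: h_def)
  \<comment> \<open>\<open>x b\<close> trivially solves the implicit equation with data
    \<open>x b - h *\<^sub>R f b (x b)\<close>, so only the two data have to be compared.\<close>
  have "norm (x b - z) \<le> exp (l * h / (1 - l * h)) * norm ((x b - h *\<^sub>R f b (x b)) - (y + h *\<^sub>R m))"
    using implicit_step_stability[OF h _ osl _ z, of "x b" "x b - h *\<^sub>R f b (x b)"] l by (simp add: h_def)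
  also have "\<dots> \<le> exp (l * h / (1 - l * h)) *
      (exp (L_M a * h) * norm (x a - y) + h * local_error T C f M L_M h a)"
  proof (rule mult_left_mono)
    have "(x b - h *\<^sub>R f b (x b)) - (y + h *\<^sub>R m) = (x b - (x a + h *\<^sub>R (f b (x b) + m))) + (x a - y)"
      by (simp add: algebra_simps)
    then have "norm ((x b - h *\<^sub>R f b (x b)) - (y + h *\<^sub>R m))
        \<le> norm (x b - (x a + h *\<^sub>R (f b (x b) + m))) + norm (x a - y)"
      by (metis norm_triangle_ineq)
    also have "\<dots> \<le> (1 + L_M a * h) * norm (x a - y) + h * local_error T C f M L_M h a"
      using err by (simp add: algebra_simps)
    also have "\<dots> \<le> exp (L_M a * h) * norm (x a - y) + h * local_error T C f M L_M h a"
      by (intro add_right_mono mult_right_mono exp_ge_add_one_self) simp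
    finally show "norm ((x b - h *\<^sub>R f b (x b)) - (y + h *\<^sub>R m))
        \<le> exp (L_M a * h) * norm (x a - y) + h * local_error T C f M L_M h a" .
  qed simp
  finally show ?thesis
    using m z unfolding semi_implicit_euler_def h_def
    by (intro bexI[of _ z] CollectI bexI[of _ m]) (auto simp: algebra_simps)
qed

end

end

section \<open>Choice of the Euler trajectory and summation of the errors\<close>

theorem corollary16:
  fixes f :: "real \<Rightarrow> real ^ 'd \<Rightarrow> real ^ 'd"
    and M :: "real \<Rightarrow> real ^ 'd \<Rightarrow> (real ^ 'd) set"
    and l_f L_M :: "real \<Rightarrow> real"
    and T C :: real
    and x0 :: "real ^ 'd"
    and N :: nat
    and t :: "nat \<Rightarrow> real"
    and x :: "real \<Rightarrow> real ^ 'd"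
  assumes "T > 0"
    and f_cont: "continuous_on ({0..T} \<times> UNIV) (\<lambda>(s, z). f s z)"
    and l_f_cont: "continuous_on {0..T} l_f"
    and f_osl: "\<And>s z z'. s \<in> {0..T} \<Longrightarrow>
        (f s z - f s z') \<bullet> (z - z') \<le> l_f s * (norm (z - z'))\<^sup>2"
    and M_values: "\<And>s z. s \<in> {0..T} \<Longrightarrow> M s z \<noteq> {} \<and> convex (M s z) \<and> compact (M s z)"
    and M_cont: "hausdorff_continuous_on ({0..T} \<times> UNIV) (\<lambda>(s, z). M s z)"
    and L_M_cont: "continuous_on {0..T} L_M"
    and L_M_nonneg: "\<And>s. s \<in> {0..T} \<Longrightarrow> L_M s \<ge> 0"
    and M_lipschitz: "\<And>s z z'. s \<in> {0..T} \<Longrightarrow>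
        hausdorff_dist (M s z) (M s z') \<le> L_M s * norm (z - z')"
    and grid: "t 0 = 0" "t N = T" "\<And>n. n < N \<Longrightarrow> t n < t (Suc n)"
    and step_restriction: "\<And>n. n < N \<Longrightarrow> l_f (t (Suc n)) * step_size t n < 1"
    and "C > 0"
    and solutions_in_ball: "\<And>u s. di_solution T (perturbed_rhs f M) x0 u \<Longrightarrow> s \<in> {0..T} \<Longrightarrow>
        u s \<in> cball 0 C"
    and trajectories_in_ball: "\<And>y n. euler_trajectory f M N t x0 y \<Longrightarrow> n \<le> N \<Longrightarrow>
        y n \<in> cball 0 C"
    and solution: "di_solution T (perturbed_rhs f M) x0 x"
  shows "\<exists>y. euler_trajectory f M N t x0 y \<and>
    (\<forall>n\<le>N. norm (x (t n) - y n) \<le>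
      (\<Sum>k<n.
         exp ((\<Sum>j=k..<n. l_f (t (Suc j)) * step_size t j / (1 - l_f (t (Suc j)) * step_size t j))
              + (\<Sum>j=Suc k..<n. L_M (t j) * step_size t j))
         * step_size t k * local_error T C f M L_M (step_size t k) (t k)))"
proof -
  interpret differential_inclusion f M L_M T C
    by unfold_locales (fact f_cont M_values M_cont L_M_nonneg M_lipschitz)+
  have in_ball: "x s \<in> cball 0 C" if "s \<in> {0..T}" for s
    using solutions_in_ball[OF solution that] .
  have mono: "t i \<le> t j" if "i \<le> j" "j \<le> N" for i j
    using that
  proof (induction j rule: dec_induct)
    case (step j)
    then show ?case using grid(3)[of j] by simp
  qed simp
  \<comment> \<open>The exponents of step \<open>j\<close>: \<open>\<alpha>\<close> stems from the
    implicit term at the right grid point, \<open>\<mu>\<close> from \<open>M\<close> at the left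
    one.\<close>
  define \<alpha> where "\<alpha> j = l_f (t (Suc j)) * step_size t j / (1 - l_f (t (Suc j)) * step_size t j)" for j
  define \<mu> where "\<mu> j = L_M (t j) * step_size t j" for j
  define \<gamma> where "\<gamma> k = step_size t k * local_error T C f M L_M (step_size t k) (t k)" for k
  define \<epsilon> where "\<epsilon> n = (\<Sum>k<n. exp (sum \<alpha> {k..<n} + sum \<mu> {Suc k..<n}) * \<gamma> k)" for n
  \<comment> \<open>Dependent choice carries the error bound along with the iterate, since each
    iterate is selected by comparison with the solution. Beyond \<open>N\<close> the requirements
    are vacuous, so the sequence may be total.\<close>
  have "\<exists>y. \<forall>n. ((n = 0 \<longrightarrow> y n = x0) \<and> (n \<le> N \<longrightarrow> norm (x (t n) - y n) \<le> \<epsilon> n)) \<and>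
      (n < N \<longrightarrow> y (Suc n) \<in> semi_implicit_euler f M (t n) (y n) (step_size t n))"
  proof (rule dependent_nat_choice)
    show "\<exists>y. (0 = 0 \<longrightarrow> y = x0) \<and> (0 \<le> N \<longrightarrow> norm (x (t 0) - y) \<le> \<epsilon> 0)"
      using solution by (simp add: grid(1) di_solution_def \<epsilon>_def)
    fix y n assume y: "(n = 0 \<longrightarrow> y = x0) \<and> (n \<le> N \<longrightarrow> norm (x (t n) - y) \<le> \<epsilon> n)"
    show "\<exists>z. ((Suc n = 0 \<longrightarrow> z = x0) \<and> (Suc n \<le> N \<longrightarrow> norm (x (t (Suc n)) - z) \<le> \<epsilon> (Suc n))) \<and>
        (n < N \<longrightarrow> z \<in> semi_implicit_euler f M (t n) y (step_size t n))"
    proof (cases "n < N")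
      case True
      have grid_n: "0 \<le> t n" "t n < t (Suc n)" "t (Suc n) \<le> T"
        using mono[of 0 n] mono[of "Suc n" N] grid True by auto
      then have "t (Suc n) \<in> {0..T}" by simp
      from euler_step_error[OF solution in_ball grid_n f_osl[OF this]] step_restriction[OF True]
      obtain z where z: "z \<in> semi_implicit_euler f M (t n) y (step_size t n)"
        and err: "norm (x (t (Suc n)) - z) \<le> exp (\<alpha> n) * (exp (\<mu> n) * norm (x (t n) - y) + \<gamma> n)"
        unfolding step_size_def \<alpha>_def \<mu>_def \<gamma>_def by blast
      note err
      also have "\<dots> \<le> exp (\<alpha> n) * (exp (\<mu> n) * \<epsilon> n + \<gamma> n)"
        using y True by (intro mult_left_mono add_right_mono) auto
      \<comment> \<open>The claimed bound satisfies the one-step recursion with equality.\<close>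
      also have "\<dots> = \<epsilon> (Suc n)"
        unfolding \<epsilon>_def sum_variation_of_constants_Suc ..
      finally show ?thesis using z by auto
    qed auto
  qed
  then obtain y where y: "y 0 = x0" "\<And>n. n \<le> N \<Longrightarrow> norm (x (t n) - y n) \<le> \<epsilon> n"
    "\<And>n. n < N \<Longrightarrow> y (Suc n) \<in> semi_implicit_euler f M (t n) (y n) (step_size t n)"
    by blast
  show ?thesis
    using y unfolding euler_trajectory_def \<epsilon>_def \<alpha>_def \<mu>_def \<gamma>_def mult.assoc
    by (intro exI[of _ y]) (simp add: mult.assoc)
qed

end
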